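(* Let $F(x)\in\mathbb{Z}_{\geq 0}[x]$ be a polynomial with $\deg F\geq 1$ and $F(0)=1$, and let $(x_n)_{n\geq 0}$ be the sequence generated from the initial values $x_0=x_1=1$ by the recurrence $$x_{n+2}\,x_n = x_{n+1}^2\,F(x_{n+1}),\qquad n\geq 0.$$ For $n\geq 0$ set $$a_{2n}=x_n,\qquad a_{2n+1}=\frac{F(x_{n+1})-1}{x_n}.$$ Then $a_{2n+1}\in\mathbb{Z}_{>0}$ for all $n\geq 0$, and for all $N\geq 1$ the partial sums of reciprocals have the continued fraction expansions $$S_N=\sum_{j=1}^N \frac{1}{x_j}=[a_0;a_1,a_2,\ldots,a_{2N-2}].$$
   Context: $\mathbb{Z}_{\geq 0}[x]$ denotes the set of polynomials with non-negative integer coefficients. Since $F(x)>0$ for $x>0$, all $x_n$ are positive and the recurrence is well defined. The notation for finite continued fractions is $$[a_0;a_1,a_2,\ldots,a_n]=a_0+\cfrac{1}{a_1+\cfrac{1}{a_2+\cdots+\cfrac{1}{a_n}}},$$ with $[a_0]=a_0$. The last coefficient is allowed to equal $1$. *)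

theory Defs
  imports Complex_Main "HOL-Computational_Algebra.Polynomial"
begin

text \<open>
  The value of a finite continued fraction with the given list of coefficients. The value at the
  empty list is a dummy, and since \<open>1 / 0 = 0\<close> in HOL, the value is meaningful only when no
  denominator vanishes, for instance when all coefficients after the first are positive.
\<close>

fun cfrac :: "real list \<Rightarrow> real" where
  "cfrac [] = 0"
| "cfrac [a] = a"
| "cfrac (a # b # as) = a + 1 / cfrac (b # as)"

end

theory Submission imports Defs
begin

text \<open>
  The ratios \<open>x (n + 1) / x n\<close> are integers, as each is the previous one times \<open>F (x n)\<close>; as
  \<open>F(c) - 1 = c Q(c)\<close>, this gives integrality. For the expansion, induction on \<open>n\<close> with the last
  coefficient left as a variable \<open>t\<close> gives
  \<open>[a\<^sub>0; \<dots>, a\<^sub>2\<^sub>n, t] = S\<^bsub>n+1\<^esub> + 1 / (c\<^sup>2 t + c\<^sup>2 / x\<^sub>n - c)\<close> with \<open>c = x\<^bsub>n+1\<^esub>\<close>; at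
  \<open>t = a\<^bsub>2n+1\<^esub> + 1 / a\<^bsub>2n+2\<^esub>\<close> the last denominator is \<open>x\<^bsub>n+2\<^esub>\<close>.
\<close>

lemma cfrac_Cons: "as \<noteq> [] \<Longrightarrow> cfrac (b # as) = b + 1 / cfrac as"
  by (cases as) auto

text \<open>Merges the last two coefficients into one real coefficient. This links expansions of
  different lengths.\<close>

lemma cfrac_append2: "cfrac (as @ [u, v]) = cfrac (as @ [u + 1 / v])"
  by (induction as) (auto simp: cfrac_Cons)

text \<open>No term of the expansion is negative and the leading one is positive; the constant term
  may vanish.\<close>

lemma poly_map_of_int_pos:
  fixes Q :: "int poly" and c :: "'a :: linordered_idom"
  assumes "\<forall>i. coeff Q i \<ge> 0" and "Q \<noteq> 0" and "c > 0"
  shows "poly (map_poly of_int Q) c > 0"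
proof -
  have "degree (map_poly (of_int :: int \<Rightarrow> 'a) Q) = degree Q"
    by (rule degree_map_poly) auto
  then have "poly (map_poly of_int Q) c = (\<Sum>i\<le>degree Q. of_int (coeff Q i) * c ^ i)"
    by (simp add: poly_altdef coeff_map_poly)
  moreover have "lead_coeff Q > 0"
    using assms by (metis leading_coeff_0_iff order_le_less)
  ultimately show ?thesis
    using assms by (auto intro!: sum_pos2[where i = "degree Q"])
qed

lemma poly_map_of_int_Ints:
  fixes c :: "'a :: comm_ring_1"
  assumes "c \<in> \<int>"
  shows "poly (map_poly of_int Q) c \<in> \<int>"
  using assms by (induction Q) (auto simp: map_poly_pCons)

text \<open>Provides the \<open>Q\<close> with F = 1 + X Q. That \<open>Q\<close> is nonzero comes
  from \<open>degree F \<ge> 1\<close> and later makes the odd coefficients strictly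
  positive.\<close>

lemma pCons_one_decomposition:
  fixes F :: "int poly"
  assumes "\<forall>i. coeff F i \<ge> 0" and "degree F \<ge> 1" and "poly F 0 = 1"
  obtains Q where "F = pCons 1 Q" and "\<forall>i. coeff Q i \<ge> 0" and "Q \<noteq> 0"
proof -
  obtain d Q where F: "F = pCons d Q" by (cases F)
  moreover have "d = 1" using assms(3) F by simp
  moreover have "\<forall>i. coeff Q i \<ge> 0" using assms(1) F by (metis coeff_pCons_Suc)
  moreover have "Q \<noteq> 0" using assms(2) F by auto
  ultimately show ?thesis using that by blast
qed

text \<open>The induction step of the expansion, with \<open>d\<close>, \<open>c\<close>,
  \<open>x'\<close> three consecutive terms of the sequence and \<open>f\<close> the value of F at
  \<open>c\<close>. With \<open>e = x' * (c * t + 1) - c\<close>, the left side is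
  \<open>(c * t + 1) / e\<close> and the right side is \<open>1 / x' + c / (x' * e)\<close>; they
  agree because \<open>e + c = x' * (c * t + 1)\<close>.\<close>

lemma reciprocal_step:
  fixes c d t x' f :: real
  assumes "c > 0" "d > 0" "t > 0" "x' \<ge> c" and x': "x' * d = c\<^sup>2 * f"
  shows "1 / (c\<^sup>2 * ((f - 1) / d + 1 / (c + 1 / t)) + c\<^sup>2 / d - c) =
    1 / x' + 1 / (x'\<^sup>2 * t + x'\<^sup>2 / c - x')"
proof -
  have pos: "c * t > 0" "c * t + 1 > 0" using assms by (auto intro: add_pos_pos)
  have "x' > 0" using assms by simp
  then have "x' * (c * t) > 0" using pos(1) by (rule mult_pos_pos)
  \<comment> \<open>The difference is \<open>x' * (c * t) + (x' - c)\<close>; this is where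
    monotonicity of the sequence enters.\<close>
  then have E: "x' * (c * t + 1) - c > 0" using \<open>x' \<ge> c\<close> by (simp only: distrib_left mult_1_right)
  have "c\<^sup>2 * ((f - 1) / d + 1 / (c + 1 / t)) + c\<^sup>2 / d - c = c\<^sup>2 * f / d + c\<^sup>2 / (c + 1 / t) - c"
    by (simp add: algebra_simps diff_divide_distrib)
  also have "c\<^sup>2 * f / d = x'" using assms by (simp add: x'[symmetric])
  also have "c\<^sup>2 / (c + 1 / t) = c\<^sup>2 * t / (c * t + 1)" using assms by (simp add: field_simps)
  also have "x' + c\<^sup>2 * t / (c * t + 1) - c = (x' * (c * t + 1) - c) / (c * t + 1)"
    using pos by (simp add: field_simps power2_eq_square)
  finally have L: "1 / (c\<^sup>2 * ((f - 1) / d + 1 / (c + 1 / t)) + c\<^sup>2 / d - c) =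
    (c * t + 1) / (x' * (c * t + 1) - c)" by simp
  have "x'\<^sup>2 * t + x'\<^sup>2 / c - x' = x' * (x' * (c * t + 1) - c) / c"
    using assms by (simp add: field_simps power2_eq_square)
  then have R: "1 / x' + 1 / (x'\<^sup>2 * t + x'\<^sup>2 / c - x') =
      1 / x' + c / (x' * (x' * (c * t + 1) - c))" by simp
  define e where "e = x' * (c * t + 1) - c"
  moreover have "c * t + 1 = (e + c) / x'" using \<open>x' > 0\<close> by (simp add: e_def)
  ultimately show ?thesis using E \<open>x' > 0\<close> unfolding L R e_def[symmetric]
    by (simp add: field_simps)
qed

theorem theorem2p1:
  fixes F :: "int poly" and x a :: "nat \<Rightarrow> real"
  assumes "\<forall>i. coeff F i \<ge> 0"
    and "degree F \<ge> 1"
    and "poly F 0 = 1"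
    and "x 0 = 1" and "x 1 = 1"
    and "\<forall>n. x (n + 2) * x n = (x (n + 1))\<^sup>2 * poly (map_poly of_int F) (x (n + 1))"
    and "\<forall>n. a (2 * n) = x n"
    and "\<forall>n. a (2 * n + 1) = (poly (map_poly of_int F) (x (n + 1)) - 1) / x n"
  shows "(\<forall>n. a (2 * n + 1) \<in> \<int> \<and> a (2 * n + 1) > 0) \<and>
    (\<forall>N\<ge>1. (\<Sum>j=1..N. 1 / x j) = cfrac (map a [0..<Suc (2 * N - 2)]))"
proof -
  obtain Q where Q: "F = pCons 1 Q" "\<forall>i. coeff Q i \<ge> 0" "Q \<noteq> 0"
    using pCons_one_decomposition assms(1-3) .
  define f where "f = (\<lambda>c :: real. poly (map_poly of_int F) c)"
  define q where "q = (\<lambda>c :: real. poly (map_poly of_int Q) c)"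
  have f_eq: "f c = 1 + c * q c" for c
    using Q(1) by (simp add: f_def q_def map_poly_pCons)
  have q_pos: "q c > 0" if "c > 0" for c
    using poly_map_of_int_pos[OF Q(2,3) that] by (simp add: q_def)
  have q_Ints: "q c \<in> \<int>" if "c \<in> \<int>" for c
    using poly_map_of_int_Ints[OF that] by (simp add: q_def)
  have rec: "x (Suc (Suc n)) * x n = (x (Suc n))\<^sup>2 * f (x (Suc n))" for n
    using assms(6) by (simp add: f_def)
  have a_even: "a (2 * n) = x n" for n using assms(7) by simp
  have a_odd: "a (Suc (2 * n)) = (f (x (Suc n)) - 1) / x n" for n
    using assms(8) by (simp add: f_def)
  have x01: "x 0 = 1" "x (Suc 0) = 1" using assms(4,5) by simp_all
  \<comment> \<open>Monotonicity is carried along for \<open>reciprocal_step\<close>: each ratio is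
    at least 1, since the previous one is and \<open>f c \<ge> 1\<close>.\<close>
  have inv: "x n > 0 \<and> x n \<le> x (Suc n) \<and> x n \<in> \<int> \<and> x (Suc n) / x n \<in> \<int>" for n
  proof (induction n)
    case 0
    then show ?case by (simp add: x01)
  next
    case (Suc n)
    define c where "c = x (Suc n)"
    have c: "c > 0" "c = x (Suc n) / x n * x n" using Suc by (auto simp: c_def)
    have c_Ints: "c \<in> \<int>" using Suc Ints_mult c(2) by metis
    have f_ge: "f c \<ge> 1" using c(1) q_pos[of c] by (simp add: f_eq)
    have f_Ints: "f c \<in> \<int>" using c_Ints q_Ints by (simp add: f_eq)
    have ratio: "x (Suc (Suc n)) = c * (c / x n * f c)"
      using rec[of n] Suc by (simp add: c_def field_simps power2_eq_square)
    have "c / x n \<ge> 1" using Suc by (simp add: c_def)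
    with f_ge have "c / x n * f c \<ge> 1" using mult_mono[of 1 "c / x n" 1 "f c"] by simp
    moreover have ratio': "x (Suc (Suc n)) / c = c / x n * f c" using ratio c(1) by simp
    ultimately have "x (Suc (Suc n)) \<ge> c" using c(1) by (metis le_divide_eq_1_pos)
    moreover have "x (Suc (Suc n)) / c \<in> \<int>"
      unfolding ratio' using f_Ints Suc by (intro Ints_mult) (simp_all add: c_def)
    ultimately show ?case using c(1) c_Ints by (simp add: c_def)
  qed
  have a_odd_eq: "a (Suc (2 * n)) = x (Suc n) / x n * q (x (Suc n))" for n
    by (simp add: a_odd f_eq)
  have a_odd_pos: "a (Suc (2 * n)) > 0" for n
    using inv[of n] inv[of "Suc n"] q_pos by (simp add: a_odd_eq)
  have a_odd_Ints: "a (Suc (2 * n)) \<in> \<int>" for n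
    using inv[of n] inv[of "Suc n"] q_Ints unfolding a_odd_eq by (blast intro: Ints_mult)
  have key: "cfrac (map a [0..<Suc (2 * n)] @ [t]) = (\<Sum>j=1..Suc n. 1 / x j) +
      1 / ((x (Suc n))\<^sup>2 * t + (x (Suc n))\<^sup>2 / x n - x (Suc n))" if "t > 0" for n t
    using that
  proof (induction n arbitrary: t)
    case 0
    then show ?case using a_even[of 0] by (simp add: x01)
  next
    case (Suc n)
    \<comment> \<open>The last three coefficients \<open>a (Suc (2 * n))\<close>,
      \<open>x (Suc n)\<close>, \<open>t\<close> collapse into the single real \<open>T\<close> by
      two merges, so the induction hypothesis, stated for arbitrary positive \<open>t\<close>,
      applies at \<open>T\<close>.\<close>
    define T where "T = a (Suc (2 * n)) + 1 / (x (Suc n) + 1 / t)"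
    have "x (Suc n) + 1 / t > 0" using inv[of "Suc n"] Suc.prems by (auto intro: add_pos_pos)
    then have T: "T > 0" using a_odd_pos[of n] by (simp add: T_def add_pos_pos)
    have "cfrac (map a [0..<Suc (2 * Suc n)] @ [t]) =
        cfrac ((map a [0..<Suc (2 * n)] @ [a (Suc (2 * n))]) @ [x (Suc n), t])"
      using a_even[of "Suc n"] by simp
    also have "\<dots> = cfrac (map a [0..<Suc (2 * n)] @ [a (Suc (2 * n)), x (Suc n) + 1 / t])"
      by (subst cfrac_append2) simp
    also have "\<dots> = cfrac (map a [0..<Suc (2 * n)] @ [T])"
      unfolding T_def by (rule cfrac_append2)
    also have "\<dots> = (\<Sum>j=1..Suc n. 1 / x j) +
        1 / ((x (Suc n))\<^sup>2 * T + (x (Suc n))\<^sup>2 / x n - x (Suc n))"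
      by (rule Suc.IH[OF T])
    also have "1 / ((x (Suc n))\<^sup>2 * T + (x (Suc n))\<^sup>2 / x n - x (Suc n)) = 1 / x (Suc (Suc n)) +
        1 / ((x (Suc (Suc n)))\<^sup>2 * t + (x (Suc (Suc n)))\<^sup>2 / x (Suc n) - x (Suc (Suc n)))"
      unfolding T_def a_odd
      using inv[of n] inv[of "Suc n"] Suc.prems rec[of n] by (intro reciprocal_step) auto
    finally show ?case by simp
  qed
  \<comment> \<open>Here N is \<open>Suc n\<close>. For \<open>n = Suc m\<close>, \<open>key\<close>
    at \<open>m\<close> gives the sum up to \<open>Suc m\<close> plus one fraction, which has to be
    the last summand \<open>1 / x (Suc n)\<close>.\<close>
  have "(\<Sum>j=1..Suc n. 1 / x j) = cfrac (map a [0..<Suc (2 * n)])" for n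
  proof (cases n)
    case 0
    then show ?thesis using a_even[of 0] by (simp add: x01)
  next
    case (Suc m)
    define T where "T = a (Suc (2 * m)) + 1 / x (Suc m)"
    have pos: "x m > 0" "x (Suc m) > 0" using inv by auto
    then have T: "T > 0" using a_odd_pos[of m] by (simp add: T_def add_pos_pos)
    \<comment> \<open>The two parts of \<open>T\<close> other than
      \<open>f (x (Suc m)) / x m\<close> cancel the correction terms, leaving what the recurrence
      equates with \<open>x (Suc (Suc m))\<close>.\<close>
    have "(x (Suc m))\<^sup>2 * T + (x (Suc m))\<^sup>2 / x m - x (Suc m) = (x (Suc m))\<^sup>2 * f (x (Suc m)) / x m"
      using pos unfolding T_def a_odd by (simp add: field_simps power2_eq_square)
    also have "\<dots> = x (Suc (Suc m))" using pos by (simp add: rec[symmetric])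
    finally have "cfrac (map a [0..<Suc (2 * m)] @ [T]) = (\<Sum>j=1..Suc n. 1 / x j)"
      using key[OF T, of m] Suc by simp
    moreover have "map a [0..<Suc (2 * n)] = map a [0..<Suc (2 * m)] @ [a (Suc (2 * m)), x (Suc m)]"
      using Suc a_even[of "Suc m"] by simp
    ultimately show ?thesis by (simp only: T_def cfrac_append2)
  qed
  \<comment> \<open>For \<open>N = Suc n\<close> the natural-number subtraction
    \<open>2 * N - 2\<close> is exactly \<open>2 * n\<close>.\<close>
  then have "(\<Sum>j=1..N. 1 / x j) = cfrac (map a [0..<Suc (2 * N - 2)])" if "N \<ge> 1" for N
    using that by (cases N) auto
  then show ?thesis using a_odd_pos a_odd_Ints by simp
qed

end
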